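(* Let $n\ge 1$ and let $q$ be an arbitrary prime power. Let $m(n,q)$ denote the largest integer $m$ for which there exist affine subspaces $A_1,\dots,A_m$ and $B_1,\dots,B_m$ of an $n$-dimensional affine space over $\mathbb{F}_q$ such that $A_i\cap B_i=\emptyset$ for each $1\le i\le m$ and $A_i\cap B_j\neq\emptyset$ whenever $1\le i<j\le m$. Then $$m(n,q)=2\cdot\frac{q^n-1}{q-1}.$$
   Context: The $n$-dimensional affine space over $\mathbb{F}_q$ is identified with $\mathbb{F}_q^n$; an affine subspace is a set of the form $v+V$ with $v\in\mathbb{F}_q^n$ and $V$ a linear subspace of $\mathbb{F}_q^n$. *)

theory Defs
  imports "HOL-Analysis.Cartesian_Space"
begin

(* The library's affine sets are over the reals only, so affine subspaces over a
   general field are defined here.  They are nonempty: cosets v + V. *)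
definition affine_subspace :: "('k::field ^ 'n) set \<Rightarrow> bool" where
  "affine_subspace S \<longleftrightarrow> (\<exists>v V. vec.subspace V \<and> S = (\<lambda>x. v + x) ` V)"

definition skew_affine_system ::
    "nat \<Rightarrow> (nat \<Rightarrow> ('k::field ^ 'n) set) \<Rightarrow> (nat \<Rightarrow> ('k ^ 'n) set) \<Rightarrow> bool" where
  "skew_affine_system m A B \<longleftrightarrow>
     (\<forall>i\<in>{1..m}. affine_subspace (A i) \<and> affine_subspace (B i)) \<and>
     (\<forall>i\<in>{1..m}. A i \<inter> B i = {}) \<and>
     (\<forall>i\<in>{1..m}. \<forall>j\<in>{1..m}. i < j \<longrightarrow> A i \<inter> B j \<noteq> {})"

definition skew_affine_sizes :: "'k::field itself \<Rightarrow> 'n::finite itself \<Rightarrow> nat set" where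
  "skew_affine_sizes _ _ =
     {m. \<exists>A B :: nat \<Rightarrow> ('k ^ 'n) set. skew_affine_system m A B}"

(* m(n,q) with q = CARD('k) and n = CARD('n).  Max is only meaningful on finite
   sets, so finiteness of skew_affine_sizes has to be stated alongside its value;
   nonemptiness is automatic, as 0 always belongs to that set. *)
definition max_skew_affine :: "'k::field itself \<Rightarrow> 'n::finite itself \<Rightarrow> nat" where
  "max_skew_affine K N = Max (skew_affine_sizes K N)"

end

theory Submission imports Defs begin

text \<open>
  Disjoint affine subspaces \<open>a + V\<close> and \<open>b + W\<close> satisfy \<open>b - a \<notin> V + W\<close>, so some linear
  functional is constant on each of them, with different values.  Up to scaling there are
  \<open>(q ^ n - 1) / (q - 1)\<close> nonzero functionals, and a single functional can serve at most two
  indices: for \<open>i < j < k\<close> the intersection conditions force its value on \<open>A i\<close> to equal its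
  values on \<open>B j\<close> and \<open>B k\<close>, and its value on \<open>A j\<close> to equal that on \<open>B k\<close>, hence the
  values on \<open>A j\<close> and \<open>B j\<close> agree.  Equality is attained by taking, for each functional, the
  two ordered pairs formed by its level sets at 0 and 1: level sets of non-proportional
  functionals always meet.
\<close>

section \<open>Linear functionals, written as scalar products\<close>

lemma scalar_product_add: "scalar_product w (x + y) = scalar_product w x + scalar_product w y"
  for w x y :: "'k::comm_semiring_1 ^ 'n"
  by (simp add: scalar_product_def algebra_simps sum.distrib)

lemma scalar_product_diff: "scalar_product w (x - y) = scalar_product w x - scalar_product w y"
  for w x y :: "'k::comm_ring_1 ^ 'n"
  by (simp add: scalar_product_def algebra_simps sum_subtractf)

lemma scalar_product_scale_right: "scalar_product w (c *s x) = c * scalar_product w x"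
  for w x :: "'k::comm_semiring_1 ^ 'n"
  by (simp add: scalar_product_def sum_distrib_left algebra_simps)

lemma scalar_product_scale_left: "scalar_product (c *s w) x = c * scalar_product w x"
  for w x :: "'k::comm_semiring_1 ^ 'n"
  by (simp add: scalar_product_def sum_distrib_left algebra_simps)

lemma scalar_product_axis: "scalar_product w (axis j c) = w $ j * c"
  for w :: "'k::comm_semiring_1 ^ 'n"
proof -
  have "scalar_product w (axis j c) = (\<Sum>i\<in>UNIV. if i = j then w $ i * c else 0)"
    unfolding scalar_product_def by (intro sum.cong) (auto simp: axis_def)
  thus ?thesis by simp
qed

text \<open>A basis of \<open>U\<close> stays independent when \<open>z\<close> is added, so a
  linear map can kill the basis and send \<open>z\<close> to a unit vector. One coordinate of that
  map is the functional.\<close>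

lemma subspace_functional_exists:
  fixes U :: "('k::field ^ 'n) set"
  assumes U: "vec.subspace U" and z: "z \<notin> U"
  obtains w where "\<And>x. x \<in> U \<Longrightarrow> scalar_product w x = 0" and "scalar_product w z = 1"
proof -
  obtain B where B: "B \<subseteq> U" "vec.independent B" "U \<subseteq> vec.span B"
    using vec.maximal_independent_subset[of U] by metis
  have span: "vec.span B = U"
    using B U by (simp add: vec.span_subspace)
  have "vec.independent (insert z B)"
    using B(2) z span by (simp add: vec.independent_insertI)
  then obtain g :: "'k ^ 'n \<Rightarrow> 'k ^ 'n" where g: "Vector_Spaces.linear (*s) (*s) g"
    and gB: "\<forall>x\<in>insert z B. g x = (if x = z then axis undefined 1 else 0)"
    using vec.linear_independent_extend[of "insert z B" "\<lambda>x. if x = z then axis undefined 1 else 0"]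
    by blast
  \<comment> \<open>A row of the matrix of \<open>g\<close> represents a coordinate of
    \<open>g\<close>. Here \<open>undefined\<close> is just some fixed index, the same one that
    carries the entry 1 in the value of \<open>g\<close> at \<open>z\<close>.\<close>
  define w where "w = matrix g $ undefined"
  have w: "scalar_product w x = g x $ undefined" for x
    by (simp add: w_def scalar_product_def matrix_works[OF g, of x, symmetric] matrix_vector_mult_def)
  have "g x = 0" if "x \<in> U" for x
  proof (rule vec.linear_eq_0_on_span[OF g])
    show "x \<in> vec.span B" using that span by simp
    show "g y = 0" if "y \<in> B" for y using that gB B(1) z by auto
  qed
  with w gB show thesis by (intro that[of w]) (auto simp: axis_def)
qed

definition separates :: "'k::field ^ 'n \<Rightarrow> ('k ^ 'n) set \<Rightarrow> ('k ^ 'n) set \<Rightarrow> bool" where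
  "separates w S T \<longleftrightarrow>
     (\<exists>a b. a \<noteq> b \<and> (\<forall>x\<in>S. scalar_product w x = a) \<and> (\<forall>x\<in>T. scalar_product w x = b))"

lemma separates_scale:
  assumes "separates w S T" "c \<noteq> 0"
  shows "separates (c *s w) S T"
proof -
  obtain a b where "a \<noteq> b" "\<forall>x\<in>S. scalar_product w x = a" "\<forall>x\<in>T. scalar_product w x = b"
    using assms(1) unfolding separates_def by blast
  thus ?thesis using assms(2) unfolding separates_def
    by (intro exI[of _ "c * a"] exI[of _ "c * b"]) (simp add: scalar_product_scale_left)
qed

lemma disjoint_affine_subspaces_separated:
  fixes S T :: "('k::field ^ 'n) set"
  assumes "affine_subspace S" "affine_subspace T" "S \<inter> T = {}"
  obtains w where "w \<noteq> 0" "separates w S T"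
proof -
  obtain a V where V: "vec.subspace V" "S = (\<lambda>x. a + x) ` V"
    using assms(1) unfolding affine_subspace_def by blast
  obtain b W where W: "vec.subspace W" "T = (\<lambda>x. b + x) ` W"
    using assms(2) unfolding affine_subspace_def by blast
  let ?U = "{x + y |x y. x \<in> V \<and> y \<in> W}"
  have "b - a \<notin> ?U"
  proof
    assume "b - a \<in> ?U"
    then obtain x y where xy: "b - a = x + y" "x \<in> V" "y \<in> W" by blast
    have "a + x = b + (- y)" using xy(1) by (simp add: algebra_simps)
    moreover have "- y \<in> W" using xy(3) W(1) by (simp add: vec.subspace_neg)
    ultimately have "a + x \<in> T" unfolding W(2) by blast
    moreover have "a + x \<in> S" using xy(2) unfolding V(2) by blast
    ultimately show False using assms(3) by blast
  qed
  moreover have "vec.subspace ?U" by (rule vec.subspace_sums[OF V(1) W(1)])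
  ultimately obtain w where w: "\<And>x. x \<in> ?U \<Longrightarrow> scalar_product w x = 0"
    "scalar_product w (b - a) = 1"
    using subspace_functional_exists by blast
  \<comment> \<open>Each of \<open>V\<close> and \<open>W\<close> lies in the sum \<open>?U\<close>,
    as the other summand may be 0.\<close>
  have "scalar_product w x = 0" if "x \<in> V \<union> W" for x
    using that w(1)[of x] vec.subspace_0[OF V(1)] vec.subspace_0[OF W(1)]
    by (metis (mono_tags, lifting) Un_iff add.left_neutral add.right_neutral mem_Collect_eq)
  moreover have "scalar_product w a \<noteq> scalar_product w b"
    using w(2) by (auto simp: scalar_product_diff)
  ultimately have "separates w S T"
    unfolding separates_def V(2) W(2)
    by (intro exI[of _ "scalar_product w a"] exI[of _ "scalar_product w b"])
       (auto simp: scalar_product_add)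
  moreover have "w \<noteq> 0" using w(2) by (auto simp: scalar_product_def)
  ultimately show thesis using that by blast
qed

section \<open>Functionals up to scaling\<close>

definition punctured_line :: "'k::field ^ 'n \<Rightarrow> ('k ^ 'n) set" where
  "punctured_line w = (\<lambda>c. c *s w) ` (- {0})"

text \<open>These are the points of the projective space of \<open>'k ^ 'n\<close>. Leaving 0 out of
  each line makes distinct lines disjoint.\<close>

definition punctured_lines :: "('k::field ^ 'n) set set" where
  "punctured_lines = punctured_line ` (- {0})"

lemma self_in_punctured_line: "w \<in> punctured_line w"
  unfolding punctured_line_def by (rule image_eqI[of _ _ 1]) auto

lemma punctured_line_eq:
  assumes "v \<in> punctured_line w"
  shows "punctured_line v = punctured_line w"
proof -
  obtain c where c: "c \<noteq> 0" "v = c *s w" using assms by (auto simp: punctured_line_def)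
  show ?thesis
  proof (intro set_eqI iffI)
    fix x assume "x \<in> punctured_line v"
    then obtain d where "d \<noteq> 0" "x = d *s v" by (auto simp: punctured_line_def)
    with c show "x \<in> punctured_line w"
      unfolding punctured_line_def by (intro image_eqI[of _ _ "d * c"]) auto
  next
    fix x assume "x \<in> punctured_line w"
    then obtain d where "d \<noteq> 0" "x = d *s w" by (auto simp: punctured_line_def)
    with c show "x \<in> punctured_line v"
      unfolding punctured_line_def by (intro image_eqI[of _ _ "d / c"]) auto
  qed
qed

text \<open>The punctured lines partition the nonzero vectors into blocks of equal size. The product
  form avoids division of natural numbers.\<close>

lemma card_punctured_lines:
  "(CARD('k) - 1) * card (punctured_lines :: ('k::{field,finite} ^ 'n) set set)
     = CARD('k) ^ CARD('n) - 1"
proof -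
  let ?L = "punctured_lines :: ('k ^ 'n) set set"
  have "card l = CARD('k) - 1" if l: "l \<in> ?L" for l
  proof -
    obtain w where "w \<noteq> 0" "l = punctured_line w" using l by (auto simp: punctured_lines_def)
    moreover from this have "inj_on (\<lambda>c. c *s w) (- {0})" by (auto intro: inj_onI)
    ultimately show ?thesis
      by (simp add: punctured_line_def card_image Compl_eq_Diff_UNIV card_Diff_subset)
  qed
  moreover have "l \<inter> l' = {}" if "l \<in> ?L" "l' \<in> ?L" "l \<noteq> l'" for l l'
    using that punctured_line_eq unfolding punctured_lines_def by blast
  ultimately have "(CARD('k) - 1) * card ?L = card (\<Union>?L)"
    by (intro card_partition) auto
  also have "\<Union>?L = - {0}"
    using self_in_punctured_line by (auto simp: punctured_lines_def punctured_line_def)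
  finally show ?thesis by (simp add: Compl_eq_Diff_UNIV card_Diff_subset)
qed

lemma card_field_ge_2: "CARD('k::{field,finite}) \<ge> 2"
  using card_mono[of "UNIV :: 'k set" "{0, 1}"] by simp

text \<open>Every index is assigned the line of a functional separating its pair; the fibres
  \<open>F l\<close> of this assignment have at most two elements each.\<close>

lemma skew_affine_system_le:
  fixes A B :: "nat \<Rightarrow> ('k::{field,finite} ^ 'n) set"
  assumes sys: "skew_affine_system m A B"
  shows "m \<le> 2 * card (punctured_lines :: ('k ^ 'n) set set)"
proof -
  have "\<exists>w. w \<noteq> 0 \<and> separates w (A i) (B i)" if "i \<in> {1..m}" for i
    using that sys disjoint_affine_subspaces_separated[of "A i" "B i"]
    unfolding skew_affine_system_def by metis
  then obtain w where w: "\<And>i. i \<in> {1..m} \<Longrightarrow> w i \<noteq> 0 \<and> separates (w i) (A i) (B i)"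
    by metis
  define F where "F l = {i \<in> {1..m}. punctured_line (w i) = l}" for l
  have "card (F l) \<le> 2" if L: "l \<in> punctured_lines" for l
  proof (cases "F l = {}")
    case False
    obtain v where l: "l = punctured_line v" using L by (auto simp: punctured_lines_def)
    have fin: "finite (F l)" by (simp add: F_def)
    \<comment> \<open>Rescaling replaces the various \<open>w i\<close> on the line \<open>l\<close>
      by the single \<open>v\<close>, so that values for different indices become
      comparable.\<close>
    have "\<exists>a b. a \<noteq> b \<and> (\<forall>x\<in>A i. scalar_product v x = a) \<and> (\<forall>x\<in>B i. scalar_product v x = b)"
      if i: "i \<in> F l" for i
    proof -
      have "v \<in> punctured_line (w i)" using i self_in_punctured_line by (simp add: F_def l)
      then obtain c where "c \<noteq> 0" "v = c *s w i" by (auto simp: punctured_line_def)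
      hence "separates v (A i) (B i)" using w[of i] i separates_scale by (auto simp: F_def)
      thus ?thesis by (simp add: separates_def)
    qed
    then obtain a b where ab: "\<And>i. i \<in> F l \<Longrightarrow> a i \<noteq> b i"
      and a: "\<And>i x. i \<in> F l \<Longrightarrow> x \<in> A i \<Longrightarrow> scalar_product v x = a i"
      and b: "\<And>i x. i \<in> F l \<Longrightarrow> x \<in> B i \<Longrightarrow> scalar_product v x = b i"
      by metis
    have eq: "a i = b j" if "i \<in> F l" "j \<in> F l" "i < j" for i j
    proof -
      have "A i \<inter> B j \<noteq> {}" using that sys by (auto simp: F_def skew_affine_system_def)
      then obtain x where "x \<in> A i" "x \<in> B j" by blast
      thus ?thesis using a b that by metis
    qed
    \<comment> \<open>With \<open>p\<close> and \<open>r\<close> the least and greatest index, a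
      \<open>j\<close> strictly between them would give
      \<open>a j = b r = a p = b j\<close>.\<close>
    have "F l \<subseteq> {Min (F l), Max (F l)}"
    proof
      fix j assume j: "j \<in> F l"
      show "j \<in> {Min (F l), Max (F l)}"
      proof (rule ccontr)
        assume "j \<notin> {Min (F l), Max (F l)}"
        hence "Min (F l) < j" "j < Max (F l)"
          using j fin by (auto simp: order_less_le)
        moreover have "Min (F l) \<in> F l" "Max (F l) \<in> F l" using fin False by auto
        ultimately have "a j = b j" using eq j by (metis order_less_trans)
        with ab[OF j] show False by simp
      qed
    qed
    hence "card (F l) \<le> card {Min (F l), Max (F l)}" by (intro card_mono) auto
    also have "\<dots> \<le> 2" by (simp add: card_insert_if)
    finally show ?thesis .
  qed simp
  moreover have "m \<le> (\<Sum>l\<in>punctured_lines. card (F l))"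
  proof -
    have "i \<in> F (punctured_line (w i)) \<and> punctured_line (w i) \<in> punctured_lines"
      if "i \<in> {1..m}" for i
      using that w[OF that] by (simp add: F_def punctured_lines_def)
    hence "{1..m} \<subseteq> (\<Union>l\<in>punctured_lines. F l)" by blast
    hence "card {1..m} \<le> card (\<Union>l\<in>punctured_lines. F l)"
      by (intro card_mono) (auto simp: F_def)
    also have "\<dots> \<le> (\<Sum>l\<in>punctured_lines. card (F l))" by (intro card_UN_le) simp
    finally show ?thesis by simp
  qed
  moreover have "(\<Sum>l\<in>punctured_lines. card (F l)) \<le> (\<Sum>l\<in>(punctured_lines :: ('k ^ 'n) set set). 2)"
    by (rule sum_mono) (fact calculation(1))
  ultimately show ?thesis by simp
qed

section \<open>Construction attaining the bound\<close>

lemma affine_subspace_level_set: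
  fixes w :: "'k::field ^ 'n"
  assumes "w \<noteq> 0"
  shows "affine_subspace {x. scalar_product w x = c}"
proof -
  obtain j where j: "w $ j \<noteq> 0" using assms by (auto simp: vec_eq_iff)
  let ?v = "axis j (c / w $ j)"
  have v: "scalar_product w ?v = c" using j by (simp add: scalar_product_axis)
  have "scalar_product w 0 = 0" by (simp add: scalar_product_def)
  hence "vec.subspace {x. scalar_product w x = 0}"
    by (simp add: vec.subspace_def scalar_product_add scalar_product_scale_right)
  moreover have "{x. scalar_product w x = c} = (\<lambda>x. ?v + x) ` {x. scalar_product w x = 0}"
  proof (intro set_eqI iffI)
    fix x assume "x \<in> {x. scalar_product w x = c}"
    hence "x - ?v \<in> {x. scalar_product w x = 0}" by (simp add: scalar_product_diff v)
    thus "x \<in> (\<lambda>x. ?v + x) ` {x. scalar_product w x = 0}"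
      by (rule image_eqI[rotated]) simp
  qed (auto simp: scalar_product_add v)
  ultimately show ?thesis unfolding affine_subspace_def by blast
qed

text \<open>Two non-proportional functionals take every pair of values jointly; a solution exists
  already among vectors supported on two coordinates.\<close>

lemma level_sets_meet:
  fixes v w :: "'k::field ^ 'n"
  assumes w: "w \<noteq> 0" and v: "v \<noteq> 0" and ne: "punctured_line v \<noteq> punctured_line w"
  shows "{x. scalar_product v x = a} \<inter> {x. scalar_product w x = b} \<noteq> {}"
proof -
  obtain j where j: "w $ j \<noteq> 0" using w by (auto simp: vec_eq_iff)
  \<comment> \<open>This \<open>r\<close> cancels coordinate \<open>j\<close> in
    \<open>v - r *s w\<close>, which is nonzero and so has a nonzero entry at some other
    \<open>k\<close>.\<close>
  define r where "r = v $ j / w $ j"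
  have "v \<noteq> r *s w"
  proof
    assume *: "v = r *s w"
    with v have "r \<noteq> 0" by auto
    with * have "v \<in> punctured_line w" by (auto simp: punctured_line_def)
    with ne punctured_line_eq show False by blast
  qed
  then obtain k where "v $ k \<noteq> r * w $ k" by (auto simp: vec_eq_iff)
  hence d: "v $ k - r * w $ k \<noteq> 0" by simp
  \<comment> \<open>The value of \<open>v - r *s w\<close> at \<open>?x\<close> depends on
    \<open>t\<close> alone and must be \<open>a - r * b\<close>; then \<open>s\<close> adjusts the
    value of \<open>w\<close> to \<open>b\<close>.\<close>
  define t where "t = (a - r * b) / (v $ k - r * w $ k)"
  define s where "s = (b - w $ k * t) / w $ j"
  let ?x = "axis k t + axis j s"
  have wx: "scalar_product w ?x = b"
    using j by (simp add: scalar_product_add scalar_product_axis s_def)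
  have "scalar_product v ?x - r * scalar_product w ?x = (v $ k - r * w $ k) * t"
    using j by (simp add: scalar_product_add scalar_product_axis r_def algebra_simps)
  also have "\<dots> = a - r * b" using d by (simp add: t_def)
  finally have "scalar_product v ?x = a" using wx by simp
  with wx show ?thesis by blast
qed

lemma skew_affine_system_exists:
  "\<exists>A B :: nat \<Rightarrow> ('k::{field,finite} ^ 'n) set.
     skew_affine_system (2 * card (punctured_lines :: ('k ^ 'n) set set)) A B"
proof -
  let ?L = "punctured_lines :: ('k ^ 'n) set set"
  obtain h where h: "bij_betw h {0..<card ?L} ?L"
    using ex_bij_betw_nat_finite[of ?L] by auto
  have "\<exists>w. w \<noteq> 0 \<and> punctured_line w = h k" if "k < card ?L" for k
    using bij_betwE[OF h] that by (force simp: punctured_lines_def)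
  then obtain u where u: "\<And>k. k < card ?L \<Longrightarrow> u k \<noteq> 0 \<and> punctured_line (u k) = h k"
    by metis
  \<comment> \<open>Indices start at 1, so \<open>2 * k + 1\<close> and \<open>2 * k + 2\<close>
    share the functional \<open>u k\<close>, with the two level sets swapped.\<close>
  define w where "w i = u ((i - 1) div 2)" for i :: nat
  define A where "A i = {x. scalar_product (w i) x = (if odd i then 0 else 1)}" for i
  define B where "B i = {x. scalar_product (w i) x = (if odd i then 1 else 0)}" for i
  have ind: "(i - 1) div 2 < card ?L" if "i \<in> {1..2 * card ?L}" for i
    using that by auto
  have "A i \<inter> B j \<noteq> {}" if ij: "i \<in> {1..2 * card ?L}" "j \<in> {1..2 * card ?L}" "i < j" for i j
  proof (cases "(i - 1) div 2 = (j - 1) div 2")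
    case True
    \<comment> \<open>Since \<open>i < j\<close>, these are the two indices of one pair in order,
      and both \<open>A i\<close> and \<open>B j\<close> are the level set at 0.\<close>
    hence "odd i" "even j" "w i = w j" using ij by (auto simp: w_def) presburger+
    hence eq: "A i = B j" by (simp add: A_def B_def)
    have "affine_subspace (A i)"
      unfolding A_def by (rule affine_subspace_level_set) (use u ind ij w_def in metis)
    thus ?thesis using eq vec.subspace_0 unfolding affine_subspace_def by blast
  next
    case False
    hence "h ((i - 1) div 2) \<noteq> h ((j - 1) div 2)"
      using h ind ij(1,2) unfolding bij_betw_def inj_on_def by (metis atLeastLessThan_iff zero_le)
    thus ?thesis
      unfolding A_def B_def using u ind ij by (intro level_sets_meet) (auto simp: w_def)
  qed
  moreover have "affine_subspace (A i) \<and> affine_subspace (B i)" if "i \<in> {1..2 * card ?L}" for i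
    unfolding A_def B_def w_def using u[OF ind[OF that]] by (simp add: affine_subspace_level_set)
  moreover have "A i \<inter> B i = {}" for i by (auto simp: A_def B_def)
  ultimately show ?thesis unfolding skew_affine_system_def by blast
qed

theorem theorem2p2:
  fixes q n :: nat
  assumes "CARD('k::{field,finite}) = q" and "CARD('n::finite) = n"
  shows "finite (skew_affine_sizes TYPE('k) TYPE('n)) \<and>
         real (max_skew_affine TYPE('k) TYPE('n)) = 2 * ((real q ^ n - 1) / (real q - 1))"
proof -
  let ?N = "card (punctured_lines :: ('k ^ 'n) set set)"
  have le: "m \<le> 2 * ?N" if "m \<in> skew_affine_sizes TYPE('k) TYPE('n)" for m
    using that skew_affine_system_le by (auto simp: skew_affine_sizes_def)
  hence fin: "finite (skew_affine_sizes TYPE('k) TYPE('n))"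
    using finite_nat_set_iff_bounded_le by blast
  have "2 * ?N \<in> skew_affine_sizes TYPE('k) TYPE('n)"
    using skew_affine_system_exists by (auto simp: skew_affine_sizes_def)
  with fin le have max: "max_skew_affine TYPE('k) TYPE('n) = 2 * ?N"
    unfolding max_skew_affine_def by (intro Max_eqI)
  \<comment> \<open>This makes the truncated subtraction in \<open>q - 1\<close> exact and the real
    denominator nonzero.\<close>
  have q: "q \<ge> 2" using card_field_ge_2[where 'k = 'k] assms by simp
  have "real ((q - 1) * ?N) = real (q ^ n - 1)"
    using card_punctured_lines[where 'k = 'k and 'n = 'n] assms by simp
  hence "(real q - 1) * real ?N = real q ^ n - 1"
    using q by (simp add: of_nat_diff)
  hence "real ?N = (real q ^ n - 1) / (real q - 1)"
    using q by (simp add: field_simps)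
  with fin max show ?thesis by simp
qed

end
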